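(* Let $\mathscr{C}$ be a class of static algorithms solving a problem $\Pi$, with the property that for any algorithm in $\mathscr{C}$ all its foldings on $p\ge2$ processing elements also belong to $\mathscr{C}$. Let $\mathcal{A}\in\mathscr{C}$ be a $(\gamma,p^\star)$-full network-oblivious algorithm for some $\gamma>0$ and a power of two $p^\star$. Let also $(\sigma^m_0,\dots,\sigma^m_{\log p^\star-1})$ and $(\sigma^M_0,\dots,\sigma^M_{\log p^\star-1})$ be two vectors of non-negative values, with $\sigma^m_j\le\sigma^M_j$ for every $0\le j<\log p^\star$. If $\mathcal{A}$ is $\beta$-optimal on $M(2^j,\sigma)$ with respect to $\mathscr{C}$, for $\sigma^m_{j-1}\le\sigma\le\sigma^M_{j-1}$ and $1\le j\le\log p^\star$, then, for every power of two $p\le p^\star$, $\mathcal{A}$ is $\Theta\!\left(\beta/((1+1/\gamma)\log^2p)\right)$-optimal on D-BSP$(p,\boldsymbol g,\boldsymbol\ell)$ with respect to $\mathscr{C}$ when executed with the ascend/descend protocol described in the context, as long as: (1) the execution of $\mathcal{A}$ on D-BSP$(p,\boldsymbol g,\boldsymbol\ell)$ using this protocol is in $\mathscr{C}$; (2) $g_i\ge g_{i+1}$ and $\ell_i/g_i\ge\ell_{i+1}/g_{i+1}$, for $0\le i<\log p-1$; (3) $\max_{1\le k\le\log p}\{\sigma^m_{k-1}2^k/p\}\le\ell_i/g_i\le\min_{1\le k\le\log p}\{\sigma^M_{k-1}2^k/p\}$, for $0\le i<\log p$.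
   Context: Conventions: $\log x$ means $\max\{1,\log_2 x\}$; numbers of processing elements are powers of two. Machine $M(v)$: $v$ processing elements (PEs) $P_0,\dots,P_{v-1}$, each a random access machine with unbounded local memory. An $M(v)$-algorithm runs as a sequence of supersteps, each with a label $i\in\{0,\dots,\log v-1\}$ (the label sequence is the same for all PEs). In an $i$-superstep each PE performs local computation and sends constant-size messages, only to PEs whose index agrees with its own in the $i$ most significant bits; the superstep ends with a barrier among such PEs, after which messages are available at their destinations. The algorithm is static if, for all inputs of the same size $n$, the number of supersteps, the sequence of labels, and the set of source-destination pairs of the messages of each superstep are the same. Folding: an $M(v)$-algorithm is executed on $M(p)$, $p<v$, by letting $P_j$ carry out the operations of the $v/p$ consecutively numbered PEs of $M(v)$ starting from the one with index $j(v/p)$. Supersteps with label $i<\log p$ keep their label; supersteps with label $i\ge\log p$ become local computation. For a static algorithm $\mathcal{A}$: $L^i_{\mathcal{A}}(n)$ is the set of $i$-supersteps, $S^i_{\mathcal{A}}(n)=|L^i_{\mathcal{A}}(n)|$; for $s\in L^i_{\mathcal{A}}(n)$, $i<\log p$, $h^s_{\mathcal{A}}(n,p)$ is the maximum number of messages sent by, or destined to, any processor in superstep $s$ when $\mathcal{A}$ is executed (folded) on $p$ processors (messages between PEs simulated by the same processor are not counted); $F^i_{\mathcal{A}}(n,p)=\sum_{s\in L^i_{\mathcal{A}}(n)}h^s_{\mathcal{A}}(n,p)$. Evaluation model $M(p,\sigma)$, $\sigma\ge0$: an $M(p)$ with communication complexity $H_{\mathcal{A}}(n,p,\sigma)=\sum_{i=0}^{\log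 p-1}\left(F^i_{\mathcal{A}}(n,p)+S^i_{\mathcal{A}}(n)\,\sigma\right)$. Execution model D-BSP$(p,\boldsymbol g,\boldsymbol\ell)$, with $\boldsymbol g=(g_0,\dots,g_{\log p-1})$ and $\boldsymbol\ell=(\ell_0,\dots,\ell_{\log p-1})$, where $g_i$ is an inverse measure of bandwidth and $\ell_i$ the latency plus synchronization cost of an $i$-superstep: an $M(p)$ with communication time $D_{\mathcal{A}}(n,p,\boldsymbol g,\boldsymbol\ell)=\sum_{i=0}^{\log p-1}\left(F^i_{\mathcal{A}}(n,p)g_i+S^i_{\mathcal{A}}(n)\ell_i\right)$. For $0\le k\le\log p$, a $k$-cluster is a set of all $p/2^k$ processors whose indices share the $k$ most significant bits. A network-oblivious algorithm is specified on $M(v(n))$, where $v(n)$ depends only on the input size $n$; its execution on $M(p,\sigma)$, $p\le v(n)$, is by folding. $M(p,\sigma)$-algorithms and D-BSP$(p,\boldsymbol g,\boldsymbol\ell)$-algorithms are $M(p)$-algorithms that may depend on $p,\sigma$, resp. $p,\boldsymbol g,\boldsymbol\ell$. Optimality: for $0<\beta\le1$, an $M(p,\sigma)$-algorithm $\mathcal{B}\in\mathscr{C}$ is $\beta$-optimal on $M(p,\sigma)$ with respect to $\mathscr{C}$ if $H_{\mathcal{B}}(n,p,\sigma)\le\frac1\beta H_{\mathcal{B}'}(n,p,\sigma)$ for each $M(p,\sigma)$-algorithm $\mathcal{B}'\in\mathscr{C}$ and each $n$; analogously on D-BSP$(p,\boldsymbol g,\boldsymbol\ell)$ with $D$ in place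 of $H$. For $\mathcal A$ executed with the protocol below, the communication time is that of the actual sequence of supersteps performed by the protocol. Fullness: a static network-oblivious algorithm $\mathcal A$ specified on $M(v(n))$ is $(\gamma,p)$-full, for some $\gamma>0$ and $1<p\le v(n)$, if $\sum_{i=0}^{j-1}F^i_{\mathcal A}(n,2^j)\ge\gamma\frac{p}{2^j}\sum_{i=0}^{j-1}S^i_{\mathcal A}(n)$ for every $1\le j\le\log p$ and every input size $n$. Ascend/descend protocol for executing $\mathcal A$ on D-BSP$(p,\boldsymbol g,\boldsymbol\ell)$: each processor $P_j$ carries out the operations of the $v(n)/p$ consecutively numbered PEs of $M(v(n))$ starting from index $j(v(n)/p)$, and each $i$-superstep of $\mathcal A$ with $0\le i<\log p$ is executed as follows. (Computation phase) Each processor performs the local computations of its assigned PEs. (Ascend phase) For $k=\log p-1$ down to $i+1$: within each $k$-cluster $\Gamma_k$, the messages which originate in $\Gamma_k$ but are destined outside $\Gamma_k$ are evenly distributed among the $p/2^k$ processors of $\Gamma_k$. (Descend phase) For $k=i$ to $\log p-1$: within each $k$-cluster $\Gamma_k$, the messages currently residing in $\Gamma_k$ are evenly distributed among the processors of the $(k+1)$-clusters inside $\Gamma_k$ which contain their final destinations. Each iteration of the ascend/descend phases requires a prefix-like computation to assign suitable intermediate destinations to the messages so as to guarantee their even distribution in the appropriate clusters.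
   Formalization: In descend iteration k only messages originating outside the (k+1)-cluster of their destination are redistributed (others stay put); redistributing all residing messages would make the claim false. The prefix computation is taken to be the hypercube one and charged; g_i > 0 is assumed. *)

theory Defs
  imports Complex_Main "HOL-Library.Multiset"
begin

text \<open>
  All numbers of processing elements are powers of two and are represented by their exponents:
  an argument \<open>q\<close> (or \<open>V\<close>, \<open>j\<close>, \<open>r\<close>) stands for \<open>2^q\<close> processing elements.

  Local computation is never charged, so an algorithm is represented by what it does on each input
  \<open>x\<close>: the sequence of supersteps (label and multiset of source-destination pairs, one
  pair per constant-size message) and the result. The function \<open>sz\<close> gives the size of
  an input; the input sizes are the elements of \<open>range sz\<close>.
\<close>

record superstep =
  label :: nat
  msgs :: "(nat \<times> nat) multiset"

record ('i, 'o) algorithm =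
  log_pes :: "nat \<Rightarrow> nat"
  supersteps :: "'i \<Rightarrow> superstep list"
  result :: "'i \<Rightarrow> 'o"

definition lg :: "real \<Rightarrow> real" where
  "lg x = max 1 (log 2 x)"

text \<open>
  Index of the \<open>k\<close>-cluster of \<open>P\<^sub>x\<close> in a machine with \<open>2^q\<close> processing elements,
  i.e. the \<open>k\<close> most significant bits of \<open>x\<close>. It is also the index of the processor that
  simulates \<open>P\<^sub>x\<close> when the machine is folded on \<open>2^k\<close> processors.
\<close>

definition cluster :: "nat \<Rightarrow> nat \<Rightarrow> nat \<Rightarrow> nat" where
  "cluster q k x = x div 2 ^ (q - k)"

definition valid_superstep :: "nat \<Rightarrow> superstep \<Rightarrow> bool" where
  "valid_superstep V s \<longleftrightarrow> label s < V \<and>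
     (\<forall>(a, b) \<in># msgs s. a < 2 ^ V \<and> b < 2 ^ V \<and> cluster V (label s) a = cluster V (label s) b)"

definition valid_algorithm :: "('i \<Rightarrow> nat) \<Rightarrow> ('i, 'o) algorithm \<Rightarrow> bool" where
  "valid_algorithm sz A \<longleftrightarrow>
     (\<forall>x. \<forall>s \<in> set (supersteps A x). valid_superstep (log_pes A (sz x)) s)"

definition static :: "('i \<Rightarrow> nat) \<Rightarrow> ('i, 'o) algorithm \<Rightarrow> bool" where
  "static sz A \<longleftrightarrow> (\<forall>x y. sz x = sz y \<longrightarrow> supersteps A x = supersteps A y)"

definition solves :: "('i \<Rightarrow> 'o \<Rightarrow> bool) \<Rightarrow> ('i, 'o) algorithm \<Rightarrow> bool" where
  "solves Prob A \<longleftrightarrow> (\<forall>x. Prob x (result A x))"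

definition runs_on :: "('i \<Rightarrow> nat) \<Rightarrow> nat \<Rightarrow> ('i, 'o) algorithm \<Rightarrow> bool" where
  "runs_on sz q A \<longleftrightarrow> (\<forall>n \<in> range sz. log_pes A n = q)"

text \<open>
  Folding on \<open>2^q\<close> processors. A pair with equal components is a message between elements
  simulated by the same processor; such pairs are kept here but never counted below.
\<close>

definition fold_superstep :: "nat \<Rightarrow> nat \<Rightarrow> superstep \<Rightarrow> superstep" where
  "fold_superstep V q s =
     \<lparr>label = label s, msgs = image_mset (\<lambda>(a, b). (cluster V q a, cluster V q b)) (msgs s)\<rparr>"

definition folded :: "('i \<Rightarrow> nat) \<Rightarrow> nat \<Rightarrow> ('i, 'o) algorithm \<Rightarrow> ('i, 'o) algorithm" where
  "folded sz q A =
     \<lparr>log_pes = (\<lambda>_. q),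
      supersteps = (\<lambda>x. map (fold_superstep (log_pes A (sz x)) q)
                          (filter (\<lambda>s. label s < q) (supersteps A x))),
      result = result A\<rparr>"

text \<open>
  The quantities below are meant for static algorithms and \<open>n \<in> range sz\<close>; then
  \<open>inv sz n\<close> is some input of size \<open>n\<close>, and its choice is irrelevant.
\<close>

definition L_steps :: "('i \<Rightarrow> nat) \<Rightarrow> ('i, 'o) algorithm \<Rightarrow> nat \<Rightarrow> nat \<Rightarrow> superstep list" where
  "L_steps sz A i n = filter (\<lambda>s. label s = i) (supersteps A (inv sz n))"

definition S_count :: "('i \<Rightarrow> nat) \<Rightarrow> ('i, 'o) algorithm \<Rightarrow> nat \<Rightarrow> nat \<Rightarrow> nat" where
  "S_count sz A i n = length (L_steps sz A i n)"

definition h_degree :: "nat \<Rightarrow> nat \<Rightarrow> superstep \<Rightarrow> nat" where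
  "h_degree V q s = (MAX j \<in> {..<2 ^ q}.
     max (size {#(a, b) \<in># msgs s. cluster V q a = j \<and> cluster V q b \<noteq> j#})
         (size {#(a, b) \<in># msgs s. cluster V q b = j \<and> cluster V q a \<noteq> j#}))"

definition F_degree :: "('i \<Rightarrow> nat) \<Rightarrow> ('i, 'o) algorithm \<Rightarrow> nat \<Rightarrow> nat \<Rightarrow> nat \<Rightarrow> nat" where
  "F_degree sz A i n q = (\<Sum>s \<leftarrow> L_steps sz A i n. h_degree (log_pes A n) q s)"

definition H_comm :: "('i \<Rightarrow> nat) \<Rightarrow> ('i, 'o) algorithm \<Rightarrow> nat \<Rightarrow> nat \<Rightarrow> real \<Rightarrow> real" where
  "H_comm sz A n q \<sigma> = (\<Sum>i<q. real (F_degree sz A i n q) + real (S_count sz A i n) * \<sigma>)"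

definition D_time ::
  "('i \<Rightarrow> nat) \<Rightarrow> ('i, 'o) algorithm \<Rightarrow> nat \<Rightarrow> nat \<Rightarrow> (nat \<Rightarrow> real) \<Rightarrow> (nat \<Rightarrow> real) \<Rightarrow> real" where
  "D_time sz A n q g l =
     (\<Sum>i<q. real (F_degree sz A i n q) * g i + real (S_count sz A i n) * l i)"

definition algorithm_class ::
  "('i \<Rightarrow> nat) \<Rightarrow> ('i \<Rightarrow> 'o \<Rightarrow> bool) \<Rightarrow> ('i, 'o) algorithm set \<Rightarrow> bool" where
  "algorithm_class sz Prob \<C> \<longleftrightarrow>
     (\<forall>X \<in> \<C>. valid_algorithm sz X \<and> static sz X \<and> solves Prob X) \<and>
     (\<forall>X \<in> \<C>. \<forall>q \<ge> 1. (\<forall>n \<in> range sz. q \<le> log_pes X n) \<longrightarrow> folded sz q X \<in> \<C>)"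

definition optimal_M ::
  "('i \<Rightarrow> nat) \<Rightarrow> ('i, 'o) algorithm set \<Rightarrow> real \<Rightarrow> nat \<Rightarrow> real \<Rightarrow> ('i, 'o) algorithm \<Rightarrow> bool" where
  "optimal_M sz \<C> \<beta> q \<sigma> B \<longleftrightarrow> 0 < \<beta> \<and> \<beta> \<le> 1 \<and> B \<in> \<C> \<and> runs_on sz q B \<and>
     (\<forall>B' \<in> \<C>. runs_on sz q B' \<longrightarrow>
        (\<forall>n \<in> range sz. H_comm sz B n q \<sigma> \<le> 1 / \<beta> * H_comm sz B' n q \<sigma>))"

definition optimal_DBSP ::
  "('i \<Rightarrow> nat) \<Rightarrow> ('i, 'o) algorithm set \<Rightarrow> real \<Rightarrow> nat \<Rightarrow> (nat \<Rightarrow> real) \<Rightarrow> (nat \<Rightarrow> real) \<Rightarrow>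
     ('i, 'o) algorithm \<Rightarrow> bool" where
  "optimal_DBSP sz \<C> \<beta> q g l B \<longleftrightarrow> 0 < \<beta> \<and> \<beta> \<le> 1 \<and> B \<in> \<C> \<and> runs_on sz q B \<and>
     (\<forall>B' \<in> \<C>. runs_on sz q B' \<longrightarrow>
        (\<forall>n \<in> range sz. D_time sz B n q g l \<le> 1 / \<beta> * D_time sz B' n q g l))"

definition full :: "('i \<Rightarrow> nat) \<Rightarrow> real \<Rightarrow> nat \<Rightarrow> ('i, 'o) algorithm \<Rightarrow> bool" where
  "full sz \<gamma> r A \<longleftrightarrow> 0 < \<gamma> \<and> 1 \<le> r \<and> (\<forall>n \<in> range sz. r \<le> log_pes A n) \<and>
     (\<forall>j \<in> {1..r}. \<forall>n \<in> range sz.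
        real (\<Sum>i<j. F_degree sz A i n j) \<ge> \<gamma> * (2 ^ r / 2 ^ j) * real (\<Sum>i<j. S_count sz A i n))"

text \<open>
  The ascend/descend protocol on \<open>2^q\<close> processors. The messages of a superstep (already
  folded on \<open>2^q\<close> processors) are enumerated in a list \<open>ms\<close> of source-destination pairs;
  \<open>pos m\<close> is the processor that currently holds the message with index \<open>m\<close>.

  \<open>evenly_placed\<close>: the messages in \<open>M\<close> are spread over the \<open>2^(q-k)\<close> processors of
  the \<open>k\<close>-cluster \<open>c\<close>, each of which holds the average number rounded down or up.
\<close>

definition evenly_placed :: "nat \<Rightarrow> nat \<Rightarrow> nat \<Rightarrow> nat set \<Rightarrow> (nat \<Rightarrow> nat) \<Rightarrow> bool" where
  "evenly_placed q k c M pos \<longleftrightarrow>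
     (\<forall>m \<in> M. pos m < 2 ^ q \<and> cluster q k (pos m) = c) \<and>
     (\<forall>x < 2 ^ q. cluster q k x = c \<longrightarrow>
        \<lfloor>real (card M) / 2 ^ (q - k)\<rfloor> \<le> int (card {m \<in> M. pos m = x}) \<and>
        int (card {m \<in> M. pos m = x}) \<le> \<lceil>real (card M) / 2 ^ (q - k)\<rceil>)"

definition outgoing :: "nat \<Rightarrow> (nat \<times> nat) list \<Rightarrow> nat \<Rightarrow> nat \<Rightarrow> nat set" where
  "outgoing q ms k c =
     {m. m < length ms \<and> cluster q k (fst (ms ! m)) = c \<and> cluster q k (snd (ms ! m)) \<noteq> c}"

definition incoming :: "nat \<Rightarrow> (nat \<times> nat) list \<Rightarrow> nat \<Rightarrow> nat \<Rightarrow> nat set" where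
  "incoming q ms k c =
     {m. m < length ms \<and> cluster q k (snd (ms ! m)) = c \<and> cluster q k (fst (ms ! m)) \<noteq> c}"

definition ascend_iter ::
  "nat \<Rightarrow> (nat \<times> nat) list \<Rightarrow> nat \<Rightarrow> (nat \<Rightarrow> nat) \<Rightarrow> (nat \<Rightarrow> nat) \<Rightarrow> bool" where
  "ascend_iter q ms k pos pos' \<longleftrightarrow>
     (\<forall>c < 2 ^ k. evenly_placed q k c (outgoing q ms k c) pos') \<and>
     (\<forall>m < length ms. (\<forall>c < 2 ^ k. m \<notin> outgoing q ms k c) \<longrightarrow> pos' m = pos m)"

text \<open>
  The ascend phase never moves a message out of a cluster that contains both its source and its
  destination. Hence a message originating in the \<open>(k+1)\<close>-cluster of its destination is still there,
  and it stays where it is in iteration \<open>k\<close> of the descend phase.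
\<close>

definition descend_iter ::
  "nat \<Rightarrow> (nat \<times> nat) list \<Rightarrow> nat \<Rightarrow> (nat \<Rightarrow> nat) \<Rightarrow> (nat \<Rightarrow> nat) \<Rightarrow> bool" where
  "descend_iter q ms k pos pos' \<longleftrightarrow>
     (\<forall>c < 2 ^ (k + 1). evenly_placed q (k + 1) c (incoming q ms (k + 1) c) pos') \<and>
     (\<forall>m < length ms. (\<forall>c < 2 ^ (k + 1). m \<notin> incoming q ms (k + 1) c) \<longrightarrow> pos' m = pos m)"

definition move_step ::
  "(nat \<times> nat) list \<Rightarrow> nat \<Rightarrow> (nat \<Rightarrow> nat) \<Rightarrow> (nat \<Rightarrow> nat) \<Rightarrow> superstep" where
  "move_step ms k pos pos' =
     \<lparr>label = k,
      msgs = image_mset (\<lambda>m. (pos m, pos' m)) (mset_set {m. m < length ms \<and> pos m \<noteq> pos' m})\<rparr>"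

text \<open>
  Parallel prefix within every \<open>k\<close>-cluster, by the standard hypercube algorithm: for
  \<open>j = q - 1\<close> down to \<open>k\<close>, each processor exchanges the partial sums of its
  \<open>(j+1)\<close>-cluster with the processor whose index differs in the \<open>(j+1)\<close>-st most
  significant bit only; this is a \<open>j\<close>-superstep. In the descend phase an exchanged message
  carries one counter for each of the two \<open>(k+1)\<close>-clusters inside the \<open>k\<close>-cluster.
\<close>

definition prefix_steps :: "nat \<Rightarrow> nat \<Rightarrow> superstep list" where
  "prefix_steps q k =
     map (\<lambda>j. \<lparr>label = j, msgs = image_mset (\<lambda>x. (x, flip_bit (q - Suc j) x)) (mset_set {..<2 ^ q})\<rparr>)
       (rev [k..<q])"

text \<open>
  \<open>iterations q ms R ks pos ss pos'\<close>: performing the iterations \<open>ks\<close>, each of which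
  transforms the positions as prescribed by \<open>R\<close>, leads from \<open>pos\<close> to \<open>pos'\<close> by
  the supersteps \<open>ss\<close>.
\<close>

inductive iterations ::
  "nat \<Rightarrow> (nat \<times> nat) list \<Rightarrow> (nat \<Rightarrow> (nat \<Rightarrow> nat) \<Rightarrow> (nat \<Rightarrow> nat) \<Rightarrow> bool) \<Rightarrow>
     nat list \<Rightarrow> (nat \<Rightarrow> nat) \<Rightarrow> superstep list \<Rightarrow> (nat \<Rightarrow> nat) \<Rightarrow> bool"
  for q ms R where
  Nil: "iterations q ms R [] pos [] pos"
| Cons: "R k pos pos' \<Longrightarrow> iterations q ms R ks pos' ss pos'' \<Longrightarrow>
     iterations q ms R (k # ks) pos (prefix_steps q k @ move_step ms k pos pos' # ss) pos''"

definition protocol_superstep :: "nat \<Rightarrow> nat \<Rightarrow> superstep \<Rightarrow> superstep list \<Rightarrow> bool" where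
  "protocol_superstep V q s ss \<longleftrightarrow>
     (\<exists>ms pos pos' ss1 ss2.
        mset ms = msgs (fold_superstep V q s) \<and>
        iterations q ms (ascend_iter q ms) (rev [label s + 1..<q]) (\<lambda>m. fst (ms ! m)) ss1 pos \<and>
        iterations q ms (descend_iter q ms) [label s..<q] pos ss2 pos' \<and>
        ss = ss1 @ ss2)"

text \<open>
  \<open>E\<close> is an execution of \<open>A\<close> on \<open>2^q\<close> processors by the protocol. The
  intermediate destinations are only constrained to be evenly distributed.
\<close>

definition protocol_execution ::
  "('i \<Rightarrow> nat) \<Rightarrow> nat \<Rightarrow> ('i, 'o) algorithm \<Rightarrow> ('i, 'o) algorithm \<Rightarrow> bool" where
  "protocol_execution sz q A E \<longleftrightarrow> runs_on sz q E \<and> result E = result A \<and>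
     (\<forall>x. \<exists>sss.
        list_all2 (protocol_superstep (log_pes A (sz x)) q)
          (filter (\<lambda>s. label s < q) (supersteps A x)) sss \<and>
        supersteps E x = concat sss)"

end

theory Submission
  imports Defs
begin

text \<open>
  Write \<open>p = 2^q\<close> and \<open>w\<^sub>k = 2^(k+1) / p\<close>. For a superstep of label \<open>i\<close> and degree
  \<open>h(2^j)\<close> on \<open>2^j\<close> processors, even distribution bounds the degree of iteration \<open>k \<ge> i\<close> of
  either phase by twice \<open>\<lceil>h(2^(k+1)) w\<^sub>k\<rceil>\<close>, because \<open>h(2^k) \<le> 2 h(2^(k+1))\<close>. Fullness absorbs the
  rounding and the prefix computations, so the communication time of the protocol is at most
  \<open>5 q (1 + 1/\<gamma>) \<Sum>\<^sub>k g\<^sub>k w\<^sub>k H\<^sub>A(2^(k+1), \<sigma>\<^sub>k)\<close> with \<open>\<sigma>\<^sub>k = l\<^sub>k / (g\<^sub>k w\<^sub>k)\<close>, a value at which the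
  folding of \<open>A\<close> is \<open>\<beta>\<close>-optimal. After replacing \<open>H\<^sub>A\<close> by \<open>H\<^sub>B / \<beta>\<close> for a competitor \<open>B\<close>, each of the
  \<open>q\<close> summands is at most \<open>D\<^sub>B / \<beta>\<close>, since \<open>w\<^sub>k h(2^(k+1)) \<le> h(p)\<close> and \<open>g\<close> and \<open>l\<close> are nonincreasing.
\<close>

section \<open>Clusters and degrees\<close>

lemma cluster_full [simp]: "cluster q q x = x"
  by (simp add: cluster_def)

lemma cluster_Suc: "k < q \<Longrightarrow> cluster q k x = cluster q (Suc k) x div 2"
proof -
  assume "k < q"
  then have "q - k = Suc (q - Suc k)" by simp
  then have "(2::nat) ^ (q - k) = 2 ^ (q - Suc k) * 2" by simp
  then show ?thesis by (simp only: cluster_def div_mult2_eq)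
qed

lemma cluster_cluster: "j \<le> q \<Longrightarrow> q \<le> V \<Longrightarrow> cluster q j (cluster V q x) = cluster V j x"
proof -
  assume "j \<le> q" "q \<le> V"
  then have "V - j = (V - q) + (q - j)" by simp
  then show ?thesis by (simp add: cluster_def power_add div_mult2_eq)
qed

lemma cluster_less: "x < 2 ^ q \<Longrightarrow> k \<le> q \<Longrightarrow> cluster q k x < 2 ^ k"
  by (simp add: cluster_def less_mult_imp_div_less flip: power_add)

section \<open>Degrees of one superstep on machines of different sizes\<close>

definition sent :: "nat \<Rightarrow> nat \<Rightarrow> superstep \<Rightarrow> nat \<Rightarrow> nat" where
  "sent V q s j = size {#(a, b) \<in># msgs s. cluster V q a = j \<and> cluster V q b \<noteq> j#}"

definition received :: "nat \<Rightarrow> nat \<Rightarrow> superstep \<Rightarrow> nat \<Rightarrow> nat" where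
  "received V q s j = size {#(a, b) \<in># msgs s. cluster V q b = j \<and> cluster V q a \<noteq> j#}"

lemma h_degree_eq: "h_degree V q s = (MAX j \<in> {..<2 ^ q}. max (sent V q s j) (received V q s j))"
  by (simp add: h_degree_def sent_def received_def)

lemma h_degree_leI:
  assumes "\<And>j. j < 2 ^ q \<Longrightarrow> sent V q s j \<le> B" "\<And>j. j < 2 ^ q \<Longrightarrow> received V q s j \<le> B"
  shows "h_degree V q s \<le> B"
  unfolding h_degree_eq using assms by (subst Max_le_iff) (auto simp: lessThan_empty_iff)

lemma sent_le_h_degree: "j < 2 ^ q \<Longrightarrow> sent V q s j \<le> h_degree V q s"
  unfolding h_degree_eq by (rule order_trans[OF max.cobounded1 Max_ge]) auto

lemma received_le_h_degree: "j < 2 ^ q \<Longrightarrow> received V q s j \<le> h_degree V q s"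
  unfolding h_degree_eq by (rule order_trans[OF max.cobounded2 Max_ge]) auto

lemma size_filter_le:
  assumes "\<And>x. x \<in># M \<Longrightarrow> P x \<Longrightarrow> Q x \<or> R x"
  shows "size (filter_mset P M) \<le> size (filter_mset Q M) + size (filter_mset R M)"
  using assms by (induction M) auto

text \<open>A message that leaves a \<open>k\<close>-cluster starts in one of its two halves and
  leaves that half as well, and likewise on arrival. Hence the factor 2.\<close>

lemma h_degree_halving:
  assumes "k < V"
  shows "h_degree V k s \<le> 2 * h_degree V (Suc k) s"
proof (rule h_degree_leI)
  fix j :: nat
  assume j: "j < 2 ^ k"
  have children: "cluster V k a = j \<longleftrightarrow> cluster V (Suc k) a = 2 * j \<or> cluster V (Suc k) a = Suc (2 * j)" for a
    unfolding cluster_Suc[OF assms] by presburger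
  have "sent V k s j \<le> sent V (Suc k) s (2 * j) + sent V (Suc k) s (Suc (2 * j))"
    unfolding sent_def by (rule size_filter_le) (auto simp: children)
  with j show "sent V k s j \<le> 2 * h_degree V (Suc k) s"
    using sent_le_h_degree[of "2 * j" "Suc k" V s] sent_le_h_degree[of "Suc (2 * j)" "Suc k" V s] by simp
  have "received V k s j \<le> received V (Suc k) s (2 * j) + received V (Suc k) s (Suc (2 * j))"
    unfolding received_def by (rule size_filter_le) (auto simp: children)
  with j show "received V k s j \<le> 2 * h_degree V (Suc k) s"
    using received_le_h_degree[of "2 * j" "Suc k" V s] received_le_h_degree[of "Suc (2 * j)" "Suc k" V s]
    by simp
qed

text \<open>Iterates \<open>h_degree_halving\<close>: each doubling of the machine lowers the degree
  by at most a factor 2, for which the weight \<open>2 ^ k / 2 ^ q\<close> compensates. This serves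
  the lower bound on the time of a competitor.\<close>

lemma h_degree_scaled_mono:
  assumes "k \<le> q" "q \<le> V"
  shows "real (h_degree V k s) * (2 ^ k / 2 ^ q) \<le> real (h_degree V q s)"
  using assms
proof (induction k rule: inc_induct)
  case base
  show ?case by simp
next
  case (step k)
  have "real (h_degree V k s) \<le> 2 * real (h_degree V (Suc k) s)"
    using h_degree_halving[of k V s] step by linarith
  then have "real (h_degree V k s) * (2 ^ k / 2 ^ q) \<le> 2 * real (h_degree V (Suc k) s) * (2 ^ k / 2 ^ q)"
    by (rule mult_right_mono) simp
  also have "\<dots> = real (h_degree V (Suc k) s) * (2 ^ Suc k / 2 ^ q)" by simp
  finally show ?case using step by linarith
qed

lemma h_degree_fold_superstep:
  "j \<le> q \<Longrightarrow> q \<le> V \<Longrightarrow> h_degree q j (fold_superstep V q s) = h_degree V j s"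
  by (simp add: h_degree_def fold_superstep_def filter_mset_image_mset case_prod_unfold cluster_cluster o_def)

section \<open>The cost of the protocol\<close>

text \<open>\<open>D_time\<close> groups the charges by label. A charge for each single superstep
  can instead be followed along the list that the protocol builds.\<close>

definition superstep_cost :: "nat \<Rightarrow> (nat \<Rightarrow> real) \<Rightarrow> (nat \<Rightarrow> real) \<Rightarrow> superstep \<Rightarrow> real" where
  "superstep_cost q g l s = real (h_degree q q s) * g (label s) + l (label s)"

definition total_cost :: "nat \<Rightarrow> (nat \<Rightarrow> real) \<Rightarrow> (nat \<Rightarrow> real) \<Rightarrow> superstep list \<Rightarrow> real" where
  "total_cost q g l ss = (\<Sum>s \<leftarrow> ss. superstep_cost q g l s)"

lemma total_cost_simps [simp]:
  "total_cost q g l [] = 0"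
  "total_cost q g l (s # ss) = superstep_cost q g l s + total_cost q g l ss"
  "total_cost q g l (ss @ ss') = total_cost q g l ss + total_cost q g l ss'"
  by (simp_all add: total_cost_def)

text \<open>Flipping a bit is an involution, so every processor sends one message and receives
  one.\<close>

lemma h_degree_exchange:
  "h_degree q q \<lparr>label = i, msgs = image_mset (\<lambda>x. (x, flip_bit d x)) (mset_set {..<2 ^ q})\<rparr> \<le> 1"
proof (rule h_degree_leI)
  have involution: "flip_bit d (flip_bit d x) = x" for x :: nat
    by (simp add: flip_bit_eq_xor xor.assoc)
  fix j :: nat
  have "card {x \<in> {..<2 ^ q}. x = j \<and> flip_bit d x \<noteq> j} \<le> card {j}"
    by (rule card_mono) auto
  then show "sent q q \<lparr>label = i, msgs = image_mset (\<lambda>x. (x, flip_bit d x)) (mset_set {..<2 ^ q})\<rparr> j \<le> 1"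
    by (simp add: sent_def filter_mset_image_mset case_prod_beta o_def)
  have "card {x \<in> {..<2 ^ q}. flip_bit d x = j \<and> x \<noteq> j} \<le> card {flip_bit d j}"
    by (rule card_mono) (auto simp: involution)
  then show "received q q \<lparr>label = i, msgs = image_mset (\<lambda>x. (x, flip_bit d x)) (mset_set {..<2 ^ q})\<rparr> j \<le> 1"
    by (simp add: received_def filter_mset_image_mset case_prod_beta o_def)
qed

lemma total_cost_prefix_steps:
  assumes "\<And>i. i < q \<Longrightarrow> 0 \<le> g i"
  shows "total_cost q g l (prefix_steps q k) \<le> (\<Sum>j = k..<q. g j + l j)"
proof -
  have "total_cost q g l (prefix_steps q k) \<le> (\<Sum>j \<leftarrow> rev [k..<q]. g j + l j)"
    unfolding total_cost_def prefix_steps_def map_map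
  proof (rule sum_list_mono)
    fix j
    assume "j \<in> set (rev [k..<q])"
    with assms have "0 \<le> g j" by simp
    from mult_right_mono[OF _ this, of "real (h_degree q q _)" 1] h_degree_exchange
    show "(superstep_cost q g l \<circ> (\<lambda>j. \<lparr>label = j, msgs = image_mset (\<lambda>x. (x, flip_bit (q - Suc j) x))
        (mset_set {..<2 ^ q})\<rparr>)) j \<le> g j + l j"
      by (simp add: superstep_cost_def)
  qed
  also have "\<dots> = (\<Sum>j = k..<q. g j + l j)"
    by (simp add: rev_map[symmetric] sum_list_distinct_conv_sum_set)
  finally show ?thesis .
qed

text \<open>For legal endpoints this is the union over all \<open>k\<close>-clusters of their
  outgoing sets, and equally of their incoming sets. It grows with \<open>k\<close>, and each
  iteration of either phase moves only messages of one such set.\<close>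

definition crossing :: "nat \<Rightarrow> (nat \<times> nat) list \<Rightarrow> nat \<Rightarrow> nat set" where
  "crossing q ms k = {m. m < length ms \<and> cluster q k (fst (ms ! m)) \<noteq> cluster q k (snd (ms ! m))}"

lemma finite_crossing [simp]: "finite (crossing q ms k)"
  by (simp add: crossing_def)

lemma crossing_Suc: "k < q \<Longrightarrow> crossing q ms k \<subseteq> crossing q ms (Suc k)"
  by (auto simp: crossing_def cluster_Suc)

lemma crossing_mono: "k \<le> j \<Longrightarrow> j \<le> q \<Longrightarrow> crossing q ms k \<subseteq> crossing q ms j"
proof (induction j rule: dec_induct)
  case (step j)
  then show ?case using crossing_Suc[of j q ms] by auto
qed simp

lemma h_degree_move_step:
  assumes "\<And>x. x < 2 ^ q \<Longrightarrow> card {m. m < length ms \<and> pos m \<noteq> pos' m \<and> pos m = x} \<le> B"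
    and "\<And>x. x < 2 ^ q \<Longrightarrow> card {m. m < length ms \<and> pos m \<noteq> pos' m \<and> pos' m = x} \<le> B"
  shows "h_degree q q (move_step ms k pos pos') \<le> B"
proof (rule h_degree_leI)
  fix x :: nat
  assume x: "x < 2 ^ q"
  have "{m \<in> {m. m < length ms \<and> pos m \<noteq> pos' m}. pos m = x \<and> pos' m \<noteq> x}
      = {m. m < length ms \<and> pos m \<noteq> pos' m \<and> pos m = x}" by auto
  with assms(1)[OF x] show "sent q q (move_step ms k pos pos') x \<le> B"
    by (simp add: sent_def move_step_def filter_mset_image_mset case_prod_beta o_def)
  have "{m \<in> {m. m < length ms \<and> pos m \<noteq> pos' m}. pos' m = x \<and> pos m \<noteq> x}
      = {m. m < length ms \<and> pos m \<noteq> pos' m \<and> pos' m = x}" by auto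
  with assms(2)[OF x] show "received q q (move_step ms k pos pos') x \<le> B"
    by (simp add: received_def move_step_def filter_mset_image_mset case_prod_beta o_def)
qed

text \<open>\<open>b k\<close> bounds the load of a processor after an even distribution at level
  \<open>k\<close>. It stays abstract here because the invariant needs only these bounds and
  monotonicity; it is later the rounded-up average
  \<open>h_degree q k t / 2 ^ (q - k)\<close>.\<close>

locale routing =
  fixes q :: nat and ms :: "(nat \<times> nat) list" and b :: "nat \<Rightarrow> nat"
  assumes endpoints: "m < length ms \<Longrightarrow> fst (ms ! m) < 2 ^ q \<and> snd (ms ! m) < 2 ^ q"
    and b_Suc: "k < q \<Longrightarrow> b k \<le> b (Suc k)"
    and outgoing_le: "k \<le> q \<Longrightarrow> c < 2 ^ k \<Longrightarrow> \<lceil>real (card (outgoing q ms k c)) / 2 ^ (q - k)\<rceil> \<le> int (b k)"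
    and incoming_le: "k \<le> q \<Longrightarrow> c < 2 ^ k \<Longrightarrow> \<lceil>real (card (incoming q ms k c)) / 2 ^ (q - k)\<rceil> \<le> int (b k)"
begin

text \<open>
  The invariant of both phases, before iteration \<open>k\<close> of the descend phase and after iteration
  \<open>k\<close> of the ascend phase: a message that leaves its \<open>k\<close>-cluster has last been
  distributed at level \<open>k\<close>, any other one at the topmost level \<open>j\<close> at which it leaves its
  \<open>j\<close>-cluster.
\<close>

definition balanced :: "nat \<Rightarrow> (nat \<Rightarrow> nat) \<Rightarrow> bool" where
  "balanced k pos \<longleftrightarrow>
     (\<forall>x < 2 ^ q. card {m \<in> crossing q ms k. pos m = x} \<le> b k) \<and>
     (\<forall>j \<in> {k<..q}. \<forall>x < 2 ^ q. card {m \<in> crossing q ms j - crossing q ms (j - 1). pos m = x} \<le> b j)"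

lemma crossing_outgoing:
  "k \<le> q \<Longrightarrow> m < length ms \<Longrightarrow> m \<in> crossing q ms k \<longleftrightarrow> (\<exists>c < 2 ^ k. m \<in> outgoing q ms k c)"
  using cluster_less endpoints by (fastforce simp: crossing_def outgoing_def)

lemma crossing_incoming:
  "k \<le> q \<Longrightarrow> m < length ms \<Longrightarrow> m \<in> crossing q ms k \<longleftrightarrow> (\<exists>c < 2 ^ k. m \<in> incoming q ms k c)"
  using cluster_less endpoints by (fastforce simp: crossing_def incoming_def)

text \<open>A \<open>q\<close>-cluster is a single processor, so the crossing messages it holds at
  the start form its outgoing set. There is no level above \<open>q\<close> to check.\<close>

lemma balanced_initial: "balanced q (\<lambda>m. fst (ms ! m))"
proof -
  have "card {m \<in> crossing q ms q. fst (ms ! m) = x} \<le> b q" if "x < 2 ^ q" for x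
  proof -
    have "{m \<in> crossing q ms q. fst (ms ! m) = x} = outgoing q ms q x"
      by (auto simp: crossing_def outgoing_def)
    with outgoing_le[of q x] that show ?thesis by simp
  qed
  then show ?thesis by (simp add: balanced_def)
qed

text \<open>The distribution keeps a message inside the \<open>k\<close>-cluster of its source. So
  the crossing messages that \<open>x\<close> holds afterwards all belong to the outgoing set of the
  \<open>k\<close>-cluster of \<open>x\<close>, of which it holds at most the rounded
  average.\<close>

lemma ascend_load:
  assumes "ascend_iter q ms k pos pos'" "k \<le> q" "x < 2 ^ q"
  shows "card {m \<in> crossing q ms k. pos' m = x} \<le> b k"
proof -
  have c: "cluster q k x < 2 ^ k" using assms by (simp add: cluster_less)
  have even: "evenly_placed q k c (outgoing q ms k c) pos'" if "c < 2 ^ k" for c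
    using assms that by (simp add: ascend_iter_def)
  have "{m \<in> crossing q ms k. pos' m = x} \<subseteq> {m \<in> outgoing q ms k (cluster q k x). pos' m = x}"
  proof
    fix m
    assume "m \<in> {m \<in> crossing q ms k. pos' m = x}"
    then have m: "m \<in> crossing q ms k" and x: "pos' m = x" by auto
    from m have "m < length ms" by (simp add: crossing_def)
    with m assms(2) obtain c' where "c' < 2 ^ k" "m \<in> outgoing q ms k c'"
      by (auto simp: crossing_outgoing)
    with even[of c'] x show "m \<in> {m \<in> outgoing q ms k (cluster q k x). pos' m = x}"
      by (auto simp: evenly_placed_def)
  qed
  then have "card {m \<in> crossing q ms k. pos' m = x} \<le> card {m \<in> outgoing q ms k (cluster q k x). pos' m = x}"
    by (rule card_mono[rotated]) (simp add: outgoing_def)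
  moreover have "int (card {m \<in> outgoing q ms k (cluster q k x). pos' m = x}) \<le> \<lceil>real (card (outgoing q ms k (cluster q k x))) / 2 ^ (q - k)\<rceil>"
    using even[OF c] assms(3) by (simp add: evenly_placed_def)
  moreover note outgoing_le[OF assms(2) c]
  ultimately show ?thesis by linarith
qed

text \<open>Dual to \<open>ascend_load\<close>: now a message is placed inside the
  \<open>Suc k\<close>-cluster of its destination, so incoming sets take over the role of outgoing
  ones.\<close>

lemma descend_load:
  assumes "descend_iter q ms k pos pos'" "k < q" "x < 2 ^ q"
  shows "card {m \<in> crossing q ms (Suc k). pos' m = x} \<le> b (Suc k)"
proof -
  have k: "Suc k \<le> q" using assms by simp
  have c: "cluster q (Suc k) x < 2 ^ Suc k" using assms by (intro cluster_less) auto
  have even: "evenly_placed q (Suc k) c (incoming q ms (Suc k) c) pos'" if "c < 2 ^ Suc k" for c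
    using assms that by (simp add: descend_iter_def)
  have "{m \<in> crossing q ms (Suc k). pos' m = x} \<subseteq> {m \<in> incoming q ms (Suc k) (cluster q (Suc k) x). pos' m = x}"
  proof
    fix m
    assume "m \<in> {m \<in> crossing q ms (Suc k). pos' m = x}"
    then have m: "m \<in> crossing q ms (Suc k)" and x: "pos' m = x" by auto
    from m have "m < length ms" by (simp add: crossing_def)
    with m k obtain c' where "c' < 2 ^ Suc k" "m \<in> incoming q ms (Suc k) c'"
      by (auto simp: crossing_incoming)
    with even[of c'] x show "m \<in> {m \<in> incoming q ms (Suc k) (cluster q (Suc k) x). pos' m = x}"
      by (auto simp: evenly_placed_def)
  qed
  then have "card {m \<in> crossing q ms (Suc k). pos' m = x}
      \<le> card {m \<in> incoming q ms (Suc k) (cluster q (Suc k) x). pos' m = x}"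
    by (rule card_mono[rotated]) (simp add: incoming_def)
  moreover have "int (card {m \<in> incoming q ms (Suc k) (cluster q (Suc k) x). pos' m = x})
      \<le> \<lceil>real (card (incoming q ms (Suc k) (cluster q (Suc k) x))) / 2 ^ (q - Suc k)\<rceil>"
    using even[OF c] assms(3) by (simp add: evenly_placed_def)
  moreover note incoming_le[OF k c]
  ultimately show ?thesis by linarith
qed

section \<open>Preservation of balance and the degree of a single iteration\<close>

lemma ascend_fixed:
  "ascend_iter q ms k pos pos' \<Longrightarrow> k \<le> q \<Longrightarrow> m < length ms \<Longrightarrow> m \<notin> crossing q ms k \<Longrightarrow> pos' m = pos m"
  by (auto simp: ascend_iter_def crossing_outgoing)

lemma descend_fixed:
  "descend_iter q ms k pos pos' \<Longrightarrow> k < q \<Longrightarrow> m < length ms \<Longrightarrow> m \<notin> crossing q ms (Suc k) \<Longrightarrow> pos' m = pos m"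
  using crossing_incoming[of "Suc k" m] by (auto simp: descend_iter_def)

text \<open>Only messages that cross level \<open>k\<close> move. The layer \<open>j = Suc k\<close>
  becomes separate here and inherits its bound from the whole level \<open>Suc k\<close>; the layers
  above it are untouched.\<close>

lemma balanced_ascend:
  assumes "balanced (Suc k) pos" "ascend_iter q ms k pos pos'" "k < q"
  shows "balanced k pos'"
  unfolding balanced_def
proof (intro conjI ballI allI impI)
  fix x :: nat
  assume x: "x < 2 ^ q"
  show "card {m \<in> crossing q ms k. pos' m = x} \<le> b k"
    using ascend_load[OF assms(2) _ x] assms(3) by simp
  fix j
  assume j: "j \<in> {k<..q}"
  let ?A = "crossing q ms j - crossing q ms (j - 1)"
  have "crossing q ms k \<subseteq> crossing q ms (j - 1)" using j by (intro crossing_mono) auto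
  then have eq: "{m \<in> ?A. pos' m = x} = {m \<in> ?A. pos m = x}"
    using ascend_fixed[OF assms(2)] assms(3) by (auto simp: crossing_def)
  show "card {m \<in> ?A. pos' m = x} \<le> b j"
  proof (cases "j = Suc k")
    case True
    then have "card {m \<in> ?A. pos m = x} \<le> card {m \<in> crossing q ms (Suc k). pos m = x}"
      by (intro card_mono) auto
    also have "\<dots> \<le> b j" using assms(1) x True by (simp add: balanced_def)
    finally show ?thesis by (simp only: eq)
  next
    case False
    with j have "j \<in> {Suc k<..q}" by auto
    with assms(1) x have "card {m \<in> ?A. pos m = x} \<le> b j" unfolding balanced_def by blast
    then show ?thesis by (simp only: eq)
  qed
qed

text \<open>Level \<open>Suc k\<close> has just been redistributed, and the layers above it are
  disjoint from the moved messages.\<close>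

lemma balanced_descend:
  assumes "balanced k pos" "descend_iter q ms k pos pos'" "k < q"
  shows "balanced (Suc k) pos'"
  unfolding balanced_def
proof (intro conjI ballI allI impI)
  fix x :: nat
  assume x: "x < 2 ^ q"
  show "card {m \<in> crossing q ms (Suc k). pos' m = x} \<le> b (Suc k)"
    using descend_load[OF assms(2,3) x] .
  fix j
  assume j: "j \<in> {Suc k<..q}"
  let ?A = "crossing q ms j - crossing q ms (j - 1)"
  have "crossing q ms (Suc k) \<subseteq> crossing q ms (j - 1)" using j by (intro crossing_mono) auto
  then have "{m \<in> ?A. pos' m = x} = {m \<in> ?A. pos m = x}"
    using descend_fixed[OF assms(2,3)] by (auto simp: crossing_def)
  moreover have "j \<in> {k<..q}" using j by auto
  ultimately show "card {m \<in> ?A. pos' m = x} \<le> b j"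
    using assms(1) x unfolding balanced_def by metis
qed

text \<open>Moved messages cross level \<open>k\<close>, hence also level \<open>Suc k\<close>. The
  preceding distribution therefore bounds what a processor sends, and the new one what it
  receives.\<close>

lemma h_degree_ascend:
  assumes "balanced (Suc k) pos" "ascend_iter q ms k pos pos'" "k < q"
  shows "h_degree q q (move_step ms k pos pos') \<le> b (Suc k)"
proof (rule h_degree_move_step)
  fix x :: nat
  assume x: "x < 2 ^ q"
  have moved: "m \<in> crossing q ms k" if "m < length ms" "pos m \<noteq> pos' m" for m
    using ascend_fixed[OF assms(2), of m] that assms(3) by auto
  have "card {m. m < length ms \<and> pos m \<noteq> pos' m \<and> pos m = x} \<le> card {m \<in> crossing q ms (Suc k). pos m = x}"
    using moved crossing_Suc[OF assms(3)] by (intro card_mono) auto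
  also have "\<dots> \<le> b (Suc k)" using assms(1) x by (simp add: balanced_def)
  finally show "card {m. m < length ms \<and> pos m \<noteq> pos' m \<and> pos m = x} \<le> b (Suc k)" .
  have "card {m. m < length ms \<and> pos m \<noteq> pos' m \<and> pos' m = x} \<le> card {m \<in> crossing q ms k. pos' m = x}"
    using moved by (intro card_mono) auto
  also have "\<dots> \<le> b k" using ascend_load[OF assms(2) _ x] assms(3) by simp
  also have "\<dots> \<le> b (Suc k)" using b_Suc assms(3) .
  finally show "card {m. m < length ms \<and> pos m \<noteq> pos' m \<and> pos' m = x} \<le> b (Suc k)" .
qed

text \<open>The factor 2 arises on the sending side: the messages crossing level
  \<open>Suc k\<close> consist of those crossing level \<open>k\<close> and those that do not, two
  groups that were balanced separately.\<close>

lemma h_degree_descend: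
  assumes "balanced k pos" "descend_iter q ms k pos pos'" "k < q"
  shows "h_degree q q (move_step ms k pos pos') \<le> 2 * b (Suc k)"
proof (rule h_degree_move_step)
  fix x :: nat
  assume x: "x < 2 ^ q"
  have moved: "m \<in> crossing q ms (Suc k)" if "m < length ms" "pos m \<noteq> pos' m" for m
    using descend_fixed[OF assms(2,3), of m] that by auto
  let ?A = "{m \<in> crossing q ms k. pos m = x}"
    and ?B = "{m \<in> crossing q ms (Suc k) - crossing q ms (Suc k - 1). pos m = x}"
  have "card {m. m < length ms \<and> pos m \<noteq> pos' m \<and> pos m = x} \<le> card (?A \<union> ?B)"
    using moved by (intro card_mono) auto
  also have "\<dots> \<le> card ?A + card ?B" by (rule card_Un_le)
  also have "card ?A \<le> b k" using assms(1) x by (simp add: balanced_def)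
  also have "card ?B \<le> b (Suc k)"
    using assms(1,3) x unfolding balanced_def by (metis Suc_leI greaterThanAtMost_iff lessI)
  finally show "card {m. m < length ms \<and> pos m \<noteq> pos' m \<and> pos m = x} \<le> 2 * b (Suc k)"
    using b_Suc[OF assms(3)] by simp
  have "card {m. m < length ms \<and> pos m \<noteq> pos' m \<and> pos' m = x} \<le> card {m \<in> crossing q ms (Suc k). pos' m = x}"
    using moved by (intro card_mono) auto
  also have "\<dots> \<le> b (Suc k)" using descend_load[OF assms(2,3) x] .
  finally show "card {m. m < length ms \<and> pos m \<noteq> pos' m \<and> pos' m = x} \<le> 2 * b (Suc k)" by simp
qed

section \<open>Accumulated cost of the ascend and descend phases\<close>

context
  fixes g l :: "nat \<Rightarrow> real"
  assumes g_nonneg: "i < q \<Longrightarrow> 0 \<le> g i"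
begin

lemma total_cost_iteration:
  assumes "h_degree q q (move_step ms k pos pos') \<le> B" "k < q"
  shows "total_cost q g l (prefix_steps q k @ move_step ms k pos pos' # ss)
    \<le> (\<Sum>j = k..<q. g j + l j) + real B * g k + l k + total_cost q g l ss"
  using total_cost_prefix_steps[of q g l k] g_nonneg mult_right_mono[OF of_nat_mono[OF assms(1)] g_nonneg[OF assms(2)]]
  by (simp add: superstep_cost_def move_step_def)

text \<open>The iterations run downwards, so the induction is on the upper end \<open>n\<close>. The
  invariant is part of the conclusion because the descend phase starts from it.\<close>

lemma ascend_phase:
  assumes "iterations q ms (ascend_iter q ms) (rev [k..<n]) pos ss pos'"
    and "balanced n pos" "k \<le> n" "n \<le> q"
  shows "balanced k pos' \<and>
    total_cost q g l ss \<le> (\<Sum>j = k..<n. (\<Sum>i = j..<q. g i + l i) + real (b (Suc j)) * g j + l j)"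
  using assms
proof (induction n arbitrary: pos ss)
  case 0
  then show ?case by (auto elim: iterations.cases)
next
  case (Suc n)
  show ?case
  proof (cases "k = Suc n")
    case True
    with Suc.prems show ?thesis by (auto elim: iterations.cases)
  next
    case False
    with Suc.prems have k: "k \<le> n" by simp
    with Suc.prems(1) have "iterations q ms (ascend_iter q ms) (n # rev [k..<n]) pos ss pos'" by simp
    then obtain pos1 ss1 where 1: "ascend_iter q ms n pos pos1"
      "iterations q ms (ascend_iter q ms) (rev [k..<n]) pos1 ss1 pos'"
      "ss = prefix_steps q n @ move_step ms n pos pos1 # ss1"
      by (auto elim: iterations.cases)
    have n: "n < q" using Suc.prems by simp
    from Suc.IH[OF 1(2) balanced_ascend[OF Suc.prems(2) 1(1) n] k]
      total_cost_iteration[OF h_degree_ascend[OF Suc.prems(2) 1(1) n] n, of ss1] n k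
    show ?thesis by (simp add: 1(3))
  qed
qed

lemma descend_phase:
  assumes "iterations q ms (descend_iter q ms) [k..<q] pos ss pos'" "balanced k pos" "k \<le> q"
  shows "total_cost q g l ss \<le> (\<Sum>j = k..<q. (\<Sum>i = j..<q. g i + l i) + real (2 * b (Suc j)) * g j + l j)"
  using assms(3,1,2)
proof (induction k arbitrary: pos ss rule: inc_induct)
  case base
  then show ?case by (auto elim: iterations.cases)
next
  case (step k)
  then have "iterations q ms (descend_iter q ms) (k # [Suc k..<q]) pos ss pos'"
    by (simp add: upt_conv_Cons)
  then obtain pos1 ss1 where 1: "descend_iter q ms k pos pos1"
    "iterations q ms (descend_iter q ms) [Suc k..<q] pos1 ss1 pos'"
    "ss = prefix_steps q k @ move_step ms k pos pos1 # ss1"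
    by (auto elim: iterations.cases)
  from step.IH[OF 1(2) balanced_descend[OF step.prems(2) 1(1) step.hyps(2)]]
    total_cost_iteration[OF h_degree_descend[OF step.prems(2) 1(1) step.hyps(2)] step.hyps(2), of ss1] step.hyps
  show ?case by (simp add: 1(3) sum.atLeast_Suc_lessThan)
qed

end

end


section \<open>Communication time of an execution\<close>

text \<open>List indices distinguish equal source-destination pairs, so multiplicities become
  cardinalities of index sets.\<close>

lemma size_filter_msgs:
  "mset ms = M \<Longrightarrow> size (filter_mset P M) = card {m. m < length ms \<and> P (ms ! m)}"
  by (auto simp: length_filter_conv_card simp flip: mset_filter)

lemma card_outgoing_le:
  assumes "mset ms = msgs t" "c < 2 ^ k"
  shows "card (outgoing q ms k c) \<le> h_degree q k t"
  using sent_le_h_degree[OF assms(2), of q t]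
  by (simp add: sent_def size_filter_msgs[OF assms(1)] outgoing_def case_prod_unfold)

lemma card_incoming_le:
  assumes "mset ms = msgs t" "c < 2 ^ k"
  shows "card (incoming q ms k c) \<le> h_degree q k t"
  using received_le_h_degree[OF assms(2), of q t]
  by (simp add: received_def size_filter_msgs[OF assms(1)] incoming_def case_prod_unfold)

text \<open>From level \<open>Suc k\<close> to level \<open>k\<close> the degree at most doubles,
  while the number of processors sharing the load exactly doubles. This provides the monotonicity
  required by \<open>routing\<close>.\<close>

lemma h_degree_ceiling_mono:
  assumes "k < q"
  shows "\<lceil>real (h_degree q k t) / 2 ^ (q - k)\<rceil> \<le> \<lceil>real (h_degree q (Suc k) t) / 2 ^ (q - Suc k)\<rceil>"
proof (rule ceiling_mono)
  have "(2::real) ^ (q - k) = 2 * 2 ^ (q - Suc k)"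
    using assms by (metis Suc_diff_Suc power_Suc)
  moreover have "real (h_degree q k t) \<le> 2 * real (h_degree q (Suc k) t)"
    using h_degree_halving[OF assms, of t] by linarith
  ultimately show "real (h_degree q k t) / 2 ^ (q - k) \<le> real (h_degree q (Suc k) t) / 2 ^ (q - Suc k)"
    by (simp add: field_simps)
qed

text \<open>The 3 counts one load in the ascend phase and two in the descend phase. The 5 covers the
  prefix computations of both phases, at most \<open>2 * q * (g k + l k)\<close> per level after
  summation, together with \<open>3 * g k\<close> for rounding and \<open>2 * l k\<close> for the
  latency of the two moves.\<close>

lemma total_cost_protocol_superstep:
  assumes "protocol_superstep V q s ss" "valid_superstep V s" "label s < q" "q \<le> V"
    and g: "\<And>i. i < q \<Longrightarrow> 0 \<le> g i" and l: "\<And>i. i < q \<Longrightarrow> 0 \<le> l i"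
  shows "total_cost q g l ss \<le>
    (\<Sum>k = label s..<q. 3 * (real (h_degree V (Suc k) s) * (2 ^ Suc k / 2 ^ q) * g k) + 5 * real q * (g k + l k))"
proof -
  let ?i = "label s" and ?t = "fold_superstep V q s"
  from assms(1) obtain ms pos pos' ss1 ss2 where ms: "mset ms = msgs ?t"
    and asc: "iterations q ms (ascend_iter q ms) (rev [?i + 1..<q]) (\<lambda>m. fst (ms ! m)) ss1 pos"
    and desc: "iterations q ms (descend_iter q ms) [?i..<q] pos ss2 pos'"
    and ss: "ss = ss1 @ ss2"
    by (auto simp: protocol_superstep_def)
  define b where "b k = nat \<lceil>real (h_degree q k ?t) / 2 ^ (q - k)\<rceil>" for k
  have b_int: "int (b k) = \<lceil>real (h_degree q k ?t) / 2 ^ (q - k)\<rceil>" for k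
    unfolding b_def by (intro nat_0_le) (simp add: order_less_le_trans[of "-1" 0])
  have msg: "fst (ms ! m) < 2 ^ q \<and> snd (ms ! m) < 2 ^ q \<and>
      cluster q ?i (fst (ms ! m)) = cluster q ?i (snd (ms ! m))" if m: "m < length ms" for m
  proof -
    from m have "ms ! m \<in># msgs ?t" by (simp flip: ms)
    then obtain a a' where "(a, a') \<in># msgs s" and eq: "ms ! m = (cluster V q a, cluster V q a')"
      by (auto simp: fold_superstep_def)
    with assms(2) have "a < 2 ^ V" "a' < 2 ^ V" "cluster V ?i a = cluster V ?i a'"
      by (auto simp: valid_superstep_def)
    then show ?thesis using assms(3,4) by (simp add: eq cluster_less cluster_cluster)
  qed
  interpret routing q ms b
  proof
    fix k c :: nat
    assume c: "c < 2 ^ k"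
    show "\<lceil>real (card (outgoing q ms k c)) / 2 ^ (q - k)\<rceil> \<le> int (b k)"
      unfolding b_int using card_outgoing_le[OF ms c] by (intro ceiling_mono divide_right_mono) auto
    show "\<lceil>real (card (incoming q ms k c)) / 2 ^ (q - k)\<rceil> \<le> int (b k)"
      unfolding b_int using card_incoming_le[OF ms c] by (intro ceiling_mono divide_right_mono) auto
  next
    fix k
    assume "k < q"
    then show "b k \<le> b (Suc k)" unfolding b_def by (intro nat_mono h_degree_ceiling_mono)
  qed (use msg in auto)
  define P where "P k = (\<Sum>j = k..<q. g j + l j)" for k
  from ascend_phase[OF g asc balanced_initial] assms(3)
  have bal: "balanced (?i + 1) pos"
    and cost1: "total_cost q g l ss1 \<le> (\<Sum>j = ?i + 1..<q. P j + real (b (Suc j)) * g j + l j)"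
    by (auto simp: P_def)
  \<comment> \<open>The ascend phase ends at level \<open>?i + 1\<close>, but the descend phase
    starts at level \<open>?i\<close>. The gap closes because no message of an
    \<open>?i\<close>-superstep leaves its \<open>?i\<close>-cluster.\<close>
  have none: "crossing q ms ?i = {}" using msg by (auto simp: crossing_def)
  have "balanced ?i pos"
    unfolding balanced_def
  proof (intro conjI ballI allI impI)
    fix j x :: nat
    assume j: "j \<in> {?i<..q}" and x: "x < 2 ^ q"
    show "card {m \<in> crossing q ms j - crossing q ms (j - 1). pos m = x} \<le> b j"
    proof (cases "j = ?i + 1")
      case True
      with none bal x show ?thesis by (simp add: balanced_def)
    next
      case False
      with j have "j \<in> {?i + 1<..q}" by auto
      with bal x show ?thesis unfolding balanced_def by blast
    qed
  qed (simp add: none)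
  with descend_phase[OF g desc] assms(3)
  have cost2: "total_cost q g l ss2 \<le> (\<Sum>j = ?i..<q. P j + real (2 * b (Suc j)) * g j + l j)"
    by (simp add: P_def)
  have P_nonneg: "0 \<le> P k" for k unfolding P_def by (intro sum_nonneg) (auto simp: g l)
  \<comment> \<open>Each \<open>P j\<close> is a tail of the sum \<open>P ?i\<close>, and there are
    at most \<open>q\<close> of them. This is where one of the two factors \<open>q\<close> of the
    final bound arises.\<close>
  have "(\<Sum>j = ?i..<q. P j) \<le> (\<Sum>j = ?i..<q. P ?i)"
    unfolding P_def by (intro sum_mono sum_mono2) (auto simp: g l)
  also have "\<dots> \<le> real q * P ?i"
    using P_nonneg[of ?i] by (simp add: mult_right_mono)
  finally have sum_P: "(\<Sum>j = ?i..<q. P j) \<le> (\<Sum>j = ?i..<q. real q * (g j + l j))"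
    by (simp add: P_def sum_distrib_left)
  have b_le: "real (b (Suc j)) \<le> real (h_degree V (Suc j) s) * (2 ^ Suc j / 2 ^ q) + 1" if "j < q" for j
  proof -
    have "real (b (Suc j)) \<le> real (h_degree q (Suc j) ?t) / 2 ^ (q - Suc j) + 1"
      unfolding b_def by (simp add: of_nat_nat)
    also have "(2::real) ^ (q - Suc j) = 2 ^ q / 2 ^ Suc j" using that by (simp add: power_diff)
    finally show ?thesis using that assms(4) by (simp add: h_degree_fold_superstep)
  qed
  have "(\<Sum>j = ?i + 1..<q. P j + real (b (Suc j)) * g j + l j)
      \<le> (\<Sum>j = ?i..<q. P j + real (b (Suc j)) * g j + l j)"
    by (intro sum_mono2) (auto simp: g l P_nonneg)
  with cost1 cost2 have "total_cost q g l ss \<le> (\<Sum>j = ?i..<q. P j + real (b (Suc j)) * g j + l j)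
      + (\<Sum>j = ?i..<q. P j + real (2 * b (Suc j)) * g j + l j)"
    by (simp add: ss)
  also have "\<dots> = 2 * (\<Sum>j = ?i..<q. P j) + (\<Sum>j = ?i..<q. 3 * real (b (Suc j)) * g j + 2 * l j)"
    by (simp add: sum_distrib_left algebra_simps flip: sum.distrib)
  also have "\<dots> \<le> 2 * (\<Sum>j = ?i..<q. real q * (g j + l j)) + (\<Sum>j = ?i..<q. 3 * real (b (Suc j)) * g j + 2 * l j)"
    using sum_P by simp
  also have "\<dots> = (\<Sum>j = ?i..<q. 2 * (real q * (g j + l j)) + (3 * real (b (Suc j)) * g j + 2 * l j))"
    by (simp only: sum_distrib_left sum.distrib)
  also have "\<dots> \<le> (\<Sum>j = ?i..<q.
      3 * (real (h_degree V (Suc j) s) * (2 ^ Suc j / 2 ^ q) * g j) + 5 * real q * (g j + l j))"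
  proof (rule sum_mono)
    fix j
    assume "j \<in> {?i..<q}"
    then have j: "j < q" by simp
    define a where "a = real (h_degree V (Suc j) s) * (2 ^ Suc j / 2 ^ q)"
    have 1: "real (b (Suc j)) * g j \<le> (a + 1) * g j"
      using b_le[OF j] g[OF j] unfolding a_def by (rule mult_right_mono)
    \<comment> \<open>Since \<open>j < q\<close> forces \<open>1 \<le> q\<close>, the terms without
      a factor \<open>q\<close> fit under \<open>5 * real q\<close>.\<close>
    have "1 * g j \<le> real q * g j" "1 * l j \<le> real q * l j"
      using j by (intro mult_right_mono g l; simp)+
    with 1 l[OF j] show "2 * (real q * (g j + l j)) + (3 * real (b (Suc j)) * g j + 2 * l j)
        \<le> 3 * (real (h_degree V (Suc j) s) * (2 ^ Suc j / 2 ^ q) * g j) + 5 * real q * (g j + l j)"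
      unfolding a_def[symmetric] distrib_left distrib_right by linarith
  qed
  finally show ?thesis .
qed

section \<open>Regrouping sums over supersteps by label and by level\<close>

lemma sum_by_label:
  fixes f :: "superstep \<Rightarrow> 'b :: comm_monoid_add"
  shows "(\<Sum>i<j. \<Sum>s \<leftarrow> filter (\<lambda>s. label s = i) xs. f s) = (\<Sum>s \<leftarrow> filter (\<lambda>s. label s < j) xs. f s)"
proof (induction xs)
  case (Cons s xs)
  have "(\<Sum>i<j. \<Sum>s \<leftarrow> filter (\<lambda>s. label s = i) (s # xs). f s)
      = (\<Sum>i<j. (if i = label s then f s else 0) + (\<Sum>s \<leftarrow> filter (\<lambda>s. label s = i) xs. f s))"
    by (intro sum.cong) auto
  also have "\<dots> = (if label s < j then f s else 0) + (\<Sum>s \<leftarrow> filter (\<lambda>s. label s < j) xs. f s)"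
    by (simp add: sum.distrib Cons.IH)
  finally show ?case by simp
qed simp

text \<open>\<open>D_time\<close> ignores labels from \<open>q\<close> on whereas
  \<open>total_cost\<close> charges every superstep; the bound on the labels makes them
  agree.\<close>

lemma D_time_eq_total_cost:
  assumes "log_pes E n = q" "\<And>s. s \<in> set (supersteps E (inv sz n)) \<Longrightarrow> label s < q"
  shows "D_time sz E n q g l = total_cost q g l (supersteps E (inv sz n))"
proof -
  let ?xs = "supersteps E (inv sz n)"
  have "real (F_degree sz E i n q) * g i + real (S_count sz E i n) * l i
      = (\<Sum>s \<leftarrow> filter (\<lambda>s. label s = i) ?xs. superstep_cost q g l s)" for i
  proof -
    have "(\<Sum>s \<leftarrow> filter (\<lambda>s. label s = i) xs. superstep_cost q g l s)
      = real (\<Sum>s \<leftarrow> filter (\<lambda>s. label s = i) xs. h_degree q q s) * g i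
        + real (length (filter (\<lambda>s. label s = i) xs)) * l i" for xs
      by (induction xs) (auto simp: superstep_cost_def algebra_simps)
    then show ?thesis by (simp add: F_degree_def S_count_def L_steps_def assms(1))
  qed
  then have "D_time sz E n q g l = (\<Sum>s \<leftarrow> filter (\<lambda>s. label s < q) ?xs. superstep_cost q g l s)"
    by (simp add: D_time_def sum_by_label)
  also have "filter (\<lambda>s. label s < q) ?xs = ?xs" using assms(2) by simp
  finally show ?thesis by (simp add: total_cost_def)
qed

lemma total_cost_concat_le:
  assumes "list_all2 R xs sss" "\<And>s ss. s \<in> set xs \<Longrightarrow> R s ss \<Longrightarrow> total_cost q g l ss \<le> f s"
  shows "total_cost q g l (concat sss) \<le> (\<Sum>s \<leftarrow> xs. f s)"
  using assms by (induction rule: list_all2_induct) (auto intro: add_mono)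

text \<open>Exchanges the summations. A superstep costs something at every level from its label on,
  so level \<open>k\<close> collects the labels below \<open>Suc k\<close>, exactly those surviving
  a folding on \<open>2 ^ Suc k\<close> processors.\<close>

lemma sum_over_levels:
  fixes f :: "superstep \<Rightarrow> nat \<Rightarrow> real"
  shows "(\<Sum>s \<leftarrow> filter (\<lambda>s. label s < q) xs. \<Sum>k = label s..<q. f s k)
    = (\<Sum>k<q. \<Sum>s \<leftarrow> filter (\<lambda>s. label s < Suc k) xs. f s k)"
proof (induction xs)
  case (Cons s xs)
  have "(\<Sum>k<q. \<Sum>s \<leftarrow> filter (\<lambda>s. label s < Suc k) (s # xs). f s k)
      = (\<Sum>k<q. (if label s \<le> k then f s k else 0) + (\<Sum>s \<leftarrow> filter (\<lambda>s. label s < Suc k) xs. f s k))"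
    by (intro sum.cong) auto
  also have "\<dots> = (\<Sum>k<q. if label s \<le> k then f s k else 0)
      + (\<Sum>s \<leftarrow> filter (\<lambda>s. label s < q) xs. \<Sum>k = label s..<q. f s k)"
    by (simp add: sum.distrib Cons.IH)
  also have "(\<Sum>k<q. if label s \<le> k then f s k else 0) = (\<Sum>k = label s..<q. f s k)"
    by (simp add: sum.If_cases Collect_conj_eq[symmetric] atLeastLessThan_def atLeast_def Int_commute)
  finally show ?case by auto
qed simp

text \<open>Together with \<open>S_total\<close>, the two coefficients of the communication
  complexity as an affine function of \<open>\<sigma>\<close>; see \<open>H_comm_eq\<close>.\<close>

definition F_total :: "('i \<Rightarrow> nat) \<Rightarrow> ('i, 'o) algorithm \<Rightarrow> nat \<Rightarrow> nat \<Rightarrow> real" where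
  "F_total sz A n j = real (\<Sum>i<j. F_degree sz A i n j)"

definition S_total :: "('i \<Rightarrow> nat) \<Rightarrow> ('i, 'o) algorithm \<Rightarrow> nat \<Rightarrow> nat \<Rightarrow> real" where
  "S_total sz A n j = real (\<Sum>i<j. S_count sz A i n)"

lemma F_total_eq: "F_total sz A n j =
    (\<Sum>s \<leftarrow> filter (\<lambda>s. label s < j) (supersteps A (inv sz n)). real (h_degree (log_pes A n) j s))"
proof -
  have "real (\<Sum>s \<leftarrow> xs. f s) = (\<Sum>s \<leftarrow> xs. real (f s))" for f :: "superstep \<Rightarrow> nat" and xs
    by (induction xs) auto
  then show ?thesis by (simp only: F_total_def F_degree_def L_steps_def sum_by_label)
qed

lemma S_total_eq: "S_total sz A n j = (\<Sum>s \<leftarrow> filter (\<lambda>s. label s < j) (supersteps A (inv sz n)). 1)"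
  using sum_by_label[of "\<lambda>_. 1 :: nat" "supersteps A (inv sz n)" j]
  by (simp add: S_total_def S_count_def L_steps_def sum_list_triv)

lemma H_comm_eq: "H_comm sz A n j \<sigma> = F_total sz A n j + S_total sz A n j * \<sigma>"
  by (simp add: H_comm_def F_total_def S_total_def sum.distrib sum_distrib_right)

lemma D_time_protocol:
  assumes "protocol_execution sz q A E" "valid_algorithm sz A" "valid_algorithm sz E"
    and n: "n \<in> range sz" and "q \<le> log_pes A n"
    and g: "\<And>i. i < q \<Longrightarrow> 0 \<le> g i" and l: "\<And>i. i < q \<Longrightarrow> 0 \<le> l i"
  shows "D_time sz E n q g l \<le> (\<Sum>k<q. 3 * (F_total sz A n (Suc k) * (2 ^ Suc k / 2 ^ q) * g k)
    + 5 * real q * (g k + l k) * S_total sz A n (Suc k))"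
proof -
  let ?x = "inv sz n" and ?V = "log_pes A n"
  define f where "f s k = 3 * (real (h_degree ?V (Suc k) s) * (2 ^ Suc k / 2 ^ q) * g k) + 5 * real q * (g k + l k)"
    for s k
  have x: "sz ?x = n" using n by (rule f_inv_into_f)
  have logE: "log_pes E n = q" using assms(1) n by (auto simp: protocol_execution_def runs_on_def)
  from assms(1) x obtain sss where
    sss: "list_all2 (protocol_superstep ?V q) (filter (\<lambda>s. label s < q) (supersteps A ?x)) sss"
    and E: "supersteps E ?x = concat sss"
    unfolding protocol_execution_def by metis
  have "label s < q" if "s \<in> set (supersteps E ?x)" for s
    using assms(3) that x logE unfolding valid_algorithm_def valid_superstep_def by metis
  then have "D_time sz E n q g l = total_cost q g l (concat sss)"
    using D_time_eq_total_cost[OF logE] by (metis E)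
  also have "\<dots> \<le> (\<Sum>s \<leftarrow> filter (\<lambda>s. label s < q) (supersteps A ?x). \<Sum>k = label s..<q. f s k)"
    using sss
  proof (rule total_cost_concat_le)
    fix s ss
    assume s: "s \<in> set (filter (\<lambda>s. label s < q) (supersteps A ?x))" and ss: "protocol_superstep ?V q s ss"
    from s have "s \<in> set (supersteps A ?x)" by simp
    with assms(2) x have "valid_superstep ?V s" unfolding valid_algorithm_def by metis
    with ss s show "total_cost q g l ss \<le> (\<Sum>k = label s..<q. f s k)"
      unfolding f_def by (intro total_cost_protocol_superstep assms(5) g l) auto
  qed
  also have "\<dots> = (\<Sum>k<q. \<Sum>s \<leftarrow> filter (\<lambda>s. label s < Suc k) (supersteps A ?x). f s k)"
    by (rule sum_over_levels)
  also have "\<dots> = (\<Sum>k<q. 3 * (F_total sz A n (Suc k) * (2 ^ Suc k / 2 ^ q) * g k)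
    + 5 * real q * (g k + l k) * S_total sz A n (Suc k))"
    unfolding F_total_eq S_total_eq f_def
    by (simp only: sum_list_addf sum_list_const_mult sum_list_mult_const mult.assoc mult_1_right
        flip: sum_list_const_mult[of _ "\<lambda>_. 1"])
  finally show ?thesis .
qed

section \<open>Optimality\<close>

text \<open>Optimality is assumed for foldings, while the cost bounds concern the unfolded
  algorithm. Folding in two stages gives the same clusters, so the degrees agree.\<close>

lemma H_comm_folded:
  assumes "n \<in> range sz" "j \<le> log_pes A n"
  shows "H_comm sz (folded sz j A) n j \<sigma> = H_comm sz A n j \<sigma>"
proof -
  have x: "sz (inv sz n) = n" using assms(1) by (rule f_inv_into_f)
  have label: "label (fold_superstep V q s) = label s" for V q s by (simp add: fold_superstep_def)
  show ?thesis
    using assms(2)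
    by (simp add: H_comm_eq F_total_eq S_total_eq folded_def x filter_map o_def label h_degree_fold_superstep)
qed

lemma D_time_lower_bound:
  assumes "q \<le> log_pes B n"
    and g: "\<And>i. i < q \<Longrightarrow> 0 \<le> g i" and l: "\<And>i. i < q \<Longrightarrow> 0 \<le> l i"
    and g_anti: "\<And>i k. i \<le> k \<Longrightarrow> k < q \<Longrightarrow> g k \<le> g i"
    and l_anti: "\<And>i k. i \<le> k \<Longrightarrow> k < q \<Longrightarrow> l k \<le> l i"
  shows "(\<Sum>k<q. F_total sz B n (Suc k) * (2 ^ Suc k / 2 ^ q) * g k + S_total sz B n (Suc k) * l k)
    \<le> real q * D_time sz B n q g l"
proof -
  have "F_total sz B n (Suc k) * (2 ^ Suc k / 2 ^ q) * g k + S_total sz B n (Suc k) * l k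
      \<le> D_time sz B n q g l" if k: "k < q" for k
  proof -
    have F: "real (F_degree sz B i n (Suc k)) * (2 ^ Suc k / 2 ^ q) \<le> real (F_degree sz B i n q)" for i
    proof -
      have "real (\<Sum>s \<leftarrow> xs. f s) * c \<le> real (\<Sum>s \<leftarrow> xs. f' s)"
        if "\<And>s. real (f s) * c \<le> real (f' s)" for f f' :: "superstep \<Rightarrow> nat" and c xs
        using that by (induction xs) (auto simp: distrib_right intro!: add_mono)
      moreover have "real (h_degree (log_pes B n) (Suc k) s) * (2 ^ Suc k / 2 ^ q) \<le> real (h_degree (log_pes B n) q s)" for s
        using k assms(1) by (intro h_degree_scaled_mono) auto
      ultimately show ?thesis unfolding F_degree_def L_steps_def by blast
    qed
    have "F_total sz B n (Suc k) * (2 ^ Suc k / 2 ^ q) * g k + S_total sz B n (Suc k) * l k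
      = (\<Sum>i<Suc k. real (F_degree sz B i n (Suc k)) * (2 ^ Suc k / 2 ^ q) * g k + real (S_count sz B i n) * l k)"
      by (simp only: F_total_def S_total_def of_nat_sum sum_distrib_right sum.distrib)
    \<comment> \<open>Labels here satisfy \<open>i \<le> k\<close>, so replacing \<open>g k\<close>
      and \<open>l k\<close> by the values at \<open>i\<close> can only increase the sum.\<close>
    also have "\<dots> \<le> (\<Sum>i<Suc k. real (F_degree sz B i n q) * g i + real (S_count sz B i n) * l i)"
      using k F g[OF k] l[OF k] g_anti l_anti by (intro sum_mono add_mono mult_mono) auto
    also have "\<dots> \<le> D_time sz B n q g l"
      unfolding D_time_def using k g l by (intro sum_mono2) auto
    finally show ?thesis .
  qed
  then have "(\<Sum>k<q. F_total sz B n (Suc k) * (2 ^ Suc k / 2 ^ q) * g k + S_total sz B n (Suc k) * l k)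
      \<le> (\<Sum>k<q. D_time sz B n q g l)"
    by (intro sum_mono) auto
  then show ?thesis by simp
qed

lemma lg_power2: "1 \<le> q \<Longrightarrow> lg (2 ^ q) = real q"
  by (simp add: lg_def log_nat_power)

lemma protocol_time_bound:
  assumes cls: "algorithm_class sz Prob \<C>" and A: "A \<in> \<C>" and full: "full sz \<gamma> r A"
    and opt: "\<And>j \<sigma>. j \<in> {1..r} \<Longrightarrow> \<sigma>m (j - 1) \<le> \<sigma> \<Longrightarrow> \<sigma> \<le> \<sigma>M (j - 1) \<Longrightarrow> optimal_M sz \<C> \<beta> j \<sigma> (folded sz j A)"
    and q: "q \<le> r" and g: "\<And>i. i < q \<Longrightarrow> 0 < g i" and l: "\<And>i. i < q \<Longrightarrow> 0 \<le> l i"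
    and E: "protocol_execution sz q A E" "E \<in> \<C>"
    and g_anti: "\<And>i k. i \<le> k \<Longrightarrow> k < q \<Longrightarrow> g k \<le> g i"
    and l_anti: "\<And>i k. i \<le> k \<Longrightarrow> k < q \<Longrightarrow> l k \<le> l i"
    and range: "\<And>k. k < q \<Longrightarrow> \<sigma>m k * 2 ^ Suc k / 2 ^ q \<le> l k / g k"
      "\<And>k. k < q \<Longrightarrow> l k / g k \<le> \<sigma>M k * 2 ^ Suc k / 2 ^ q"
    and B: "B \<in> \<C>" "runs_on sz q B" and n: "n \<in> range sz" and \<beta>: "0 < \<beta>"
  shows "D_time sz E n q g l \<le> 5 * (1 + 1 / \<gamma>) * (real q)\<^sup>2 / \<beta> * D_time sz B n q g l"
proof -
  have \<gamma>: "0 < \<gamma>" using full by (simp add: full_def)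
  have logA: "r \<le> log_pes A m" if "m \<in> range sz" for m using full that by (auto simp: full_def)
  have logB: "log_pes B m = q" if "m \<in> range sz" for m using B that by (auto simp: runs_on_def)
  have g0: "0 \<le> g i" if "i < q" for i using g that by (simp add: less_imp_le)
  define w :: "nat \<Rightarrow> real" where "w k = 2 ^ Suc k / 2 ^ q" for k
  have w: "0 < w k" for k by (simp add: w_def)
  let ?FA = "\<lambda>k. F_total sz A n (Suc k)" and ?SA = "\<lambda>k. S_total sz A n (Suc k)"
  let ?FB = "\<lambda>k. F_total sz B n (Suc k)" and ?SB = "\<lambda>k. S_total sz B n (Suc k)"
  have "D_time sz E n q g l \<le> (\<Sum>k<q. 3 * (?FA k * w k * g k) + 5 * real q * (g k + l k) * ?SA k)"
    unfolding w_def using cls A E n q logA[OF n] g0 l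
    by (intro D_time_protocol) (auto simp: algorithm_class_def)
  also have "\<dots> \<le> (\<Sum>k<q. 5 * (1 + 1 / \<gamma>) * real q / \<beta> * (?FB k * w k * g k + ?SB k * l k))"
  proof (rule sum_mono)
    fix k
    assume "k \<in> {..<q}"
    then have k: "k < q" by simp
    have SA: "0 \<le> ?SA k" and FA: "0 \<le> ?FA k" by (simp_all only: S_total_def F_total_def of_nat_0_le_iff)
    have gk: "0 < g k" and lk: "0 \<le> l k" using g l k by auto
    have "\<gamma> * (2 ^ r / 2 ^ Suc k) * ?SA k \<le> ?FA k"
    proof -
      have "Suc k \<in> {1..r}" using k q by simp
      with full n show ?thesis unfolding full_def F_total_def S_total_def by blast
    qed
    \<comment> \<open>Fullness is given for \<open>2 ^ r\<close> processors;
      \<open>q \<le> r\<close> weakens its factor to the one for \<open>2 ^ q\<close>.\<close>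
    moreover have "\<gamma> * (1 / w k) * ?SA k \<le> \<gamma> * (2 ^ r / 2 ^ Suc k) * ?SA k"
      using \<gamma> SA q by (intro mult_right_mono mult_left_mono) (auto simp: w_def divide_right_mono power_increasing)
    ultimately have "\<gamma> * (1 / w k) * ?SA k \<le> ?FA k" by linarith
    then have "?SA k \<le> (1 / \<gamma>) * (?FA k * w k)"
      using \<gamma> w[of k] by (simp add: field_simps)
    then have "?SA k * g k \<le> (1 / \<gamma>) * (?FA k * w k) * g k"
      using gk by (intro mult_right_mono) auto
    then have full_k: "g k * ?SA k \<le> (1 / \<gamma>) * (?FA k * w k * g k)" by (simp add: mult_ac)
    define u where "u = ?FA k * w k * g k"
    define v where "v = l k * ?SA k"
    have u: "0 \<le> u" and v: "0 \<le> v" using FA SA w[of k] gk lk by (simp_all add: u_def v_def)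
    have "3 * u + 5 * real q * (g k + l k) * ?SA k = 3 * u + 5 * real q * (g k * ?SA k) + 5 * real q * v"
      by (simp add: v_def algebra_simps)
    \<comment> \<open>Fullness turns the bandwidth charge per superstep into a multiple of
      \<open>u\<close>; the latency charge \<open>v\<close> is kept.\<close>
    also have "\<dots> \<le> 3 * u + 5 * real q * ((1 / \<gamma>) * u) + 5 * real q * v"
      using full_k by (intro add_mono mult_left_mono) (auto simp: u_def)
    \<comment> \<open>A nonnegative multiple of \<open>v\<close> is added so that
      \<open>1 + 1 / \<gamma>\<close> factors out of \<open>u + v\<close>.\<close>
    also have "\<dots> \<le> 5 * real q * u + 5 * real q * ((1 / \<gamma>) * u) + (5 * real q * v + 5 * real q * ((1 / \<gamma>) * v))"
    proof -
      have "1 * u \<le> real q * u" using k u by (intro mult_right_mono) auto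
      moreover have "0 \<le> 5 * real q * ((1 / \<gamma>) * v)" using \<gamma> v by simp
      ultimately show ?thesis using u by linarith
    qed
    also have "\<dots> = 5 * (1 + 1 / \<gamma>) * real q * (u + v)" by (simp add: algebra_simps add_divide_distrib)
    finally have bound: "3 * u + 5 * real q * (g k + l k) * ?SA k \<le> 5 * (1 + 1 / \<gamma>) * real q * (u + v)" .
    \<comment> \<open>With this value, \<open>w k * g k\<close> times the communication complexity
      on \<open>2 ^ Suc k\<close> processors is exactly the bandwidth term plus the latency term of
      level \<open>k\<close>, for \<open>A\<close> and \<open>B\<close> alike.\<close>
    define \<sigma> where "\<sigma> = l k / g k / w k"
    have "\<sigma>m k \<le> \<sigma>" "\<sigma> \<le> \<sigma>M k"
      using range[OF k] unfolding \<sigma>_def pos_le_divide_eq[OF w] pos_divide_le_eq[OF w] by (simp_all add: w_def)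
    then have "optimal_M sz \<C> \<beta> (Suc k) \<sigma> (folded sz (Suc k) A)"
      using opt[of "Suc k" \<sigma>] k q by simp
    moreover have "folded sz (Suc k) B \<in> \<C>"
      using cls B k logB unfolding algorithm_class_def by force
    moreover have "runs_on sz (Suc k) (folded sz (Suc k) B)" by (simp add: runs_on_def folded_def)
    ultimately have "H_comm sz (folded sz (Suc k) A) n (Suc k) \<sigma>
        \<le> 1 / \<beta> * H_comm sz (folded sz (Suc k) B) n (Suc k) \<sigma>"
      using n unfolding optimal_M_def by blast
    moreover have "Suc k \<le> log_pes A n" "Suc k \<le> log_pes B n" using k q logA[OF n] logB[OF n] by auto
    ultimately have "H_comm sz A n (Suc k) \<sigma> \<le> 1 / \<beta> * H_comm sz B n (Suc k) \<sigma>"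
      using n by (simp add: H_comm_folded)
    then have "H_comm sz A n (Suc k) \<sigma> * (w k * g k) \<le> 1 / \<beta> * H_comm sz B n (Suc k) \<sigma> * (w k * g k)"
      using w[of k] gk by (intro mult_right_mono) auto
    moreover have "H_comm sz X n (Suc k) \<sigma> * (w k * g k)
        = F_total sz X n (Suc k) * w k * g k + S_total sz X n (Suc k) * l k" for X :: "('a, 'b) algorithm"
      using w[of k] gk by (simp add: H_comm_eq \<sigma>_def field_simps)
    ultimately have "u + v \<le> 1 / \<beta> * (?FB k * w k * g k + ?SB k * l k)"
      by (simp add: u_def v_def mult_ac)
    then have "5 * (1 + 1 / \<gamma>) * real q * (u + v)
        \<le> 5 * (1 + 1 / \<gamma>) * real q * (1 / \<beta> * (?FB k * w k * g k + ?SB k * l k))"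
      using \<gamma> by (intro mult_left_mono) auto
    with bound show "3 * (?FA k * w k * g k) + 5 * real q * (g k + l k) * ?SA k
        \<le> 5 * (1 + 1 / \<gamma>) * real q / \<beta> * (?FB k * w k * g k + ?SB k * l k)"
      by (simp add: u_def)
  qed
  also have "\<dots> = 5 * (1 + 1 / \<gamma>) * real q / \<beta> * (\<Sum>k<q. ?FB k * w k * g k + ?SB k * l k)"
    by (simp only: sum_distrib_left)
  also have "\<dots> \<le> 5 * (1 + 1 / \<gamma>) * real q / \<beta> * (real q * D_time sz B n q g l)"
    unfolding w_def using logB[OF n] g0 l g_anti l_anti \<gamma> \<beta>
    by (intro mult_left_mono D_time_lower_bound) auto
  finally show ?thesis by (simp add: power2_eq_square mult_ac)
qed


theorem theorem9:
  "\<exists>c1 > 0. \<exists>c2 > 0.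
    \<forall>(sz :: 'i \<Rightarrow> nat) (Prob :: 'i \<Rightarrow> 'o \<Rightarrow> bool) (\<C> :: ('i, 'o) algorithm set)
      (A :: ('i, 'o) algorithm) (\<gamma> :: real) (\<beta> :: real) (r :: nat)
      (\<sigma>m :: nat \<Rightarrow> real) (\<sigma>M :: nat \<Rightarrow> real).
      algorithm_class sz Prob \<C> \<and> A \<in> \<C> \<and> full sz \<gamma> r A \<and>
      (\<forall>j < r. 0 \<le> \<sigma>m j \<and> 0 \<le> \<sigma>M j \<and> \<sigma>m j \<le> \<sigma>M j) \<and>
      (\<forall>j \<in> {1..r}. \<forall>\<sigma>. \<sigma>m (j - 1) \<le> \<sigma> \<and> \<sigma> \<le> \<sigma>M (j - 1) \<longrightarrow>
         optimal_M sz \<C> \<beta> j \<sigma> (folded sz j A))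
      \<longrightarrow>
      (\<forall>(q :: nat) (g :: nat \<Rightarrow> real) (l :: nat \<Rightarrow> real) (E :: ('i, 'o) algorithm).
         q \<le> r \<and> (\<forall>i < q. 0 < g i) \<and> protocol_execution sz q A E \<and>
         E \<in> \<C> \<and>
         (\<forall>i. i + 1 < q \<longrightarrow> g i \<ge> g (i + 1) \<and> l i / g i \<ge> l (i + 1) / g (i + 1)) \<and>
         (\<forall>i < q. (MAX k \<in> {1..q}. \<sigma>m (k - 1) * 2 ^ k / 2 ^ q) \<le> l i / g i \<and>
                  l i / g i \<le> (MIN k \<in> {1..q}. \<sigma>M (k - 1) * 2 ^ k / 2 ^ q))
         \<longrightarrow>
         (\<exists>\<beta>'. c1 * (\<beta> / ((1 + 1 / \<gamma>) * (lg (2 ^ q))\<^sup>2)) \<le> \<beta>' \<and>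
               \<beta>' \<le> c2 * (\<beta> / ((1 + 1 / \<gamma>) * (lg (2 ^ q))\<^sup>2)) \<and>
               optimal_DBSP sz \<C> \<beta>' q g l E))"
proof (rule exI[of _ "1 / 5"], rule conjI, simp, rule exI[of _ "1 / 5"], rule conjI, simp, intro allI impI)
  fix sz :: "'i \<Rightarrow> nat" and Prob :: "'i \<Rightarrow> 'o \<Rightarrow> bool" and \<C> :: "('i, 'o) algorithm set"
    and A :: "('i, 'o) algorithm" and \<gamma> \<beta> :: real and r :: nat and \<sigma>m \<sigma>M :: "nat \<Rightarrow> real"
    and q :: nat and g l :: "nat \<Rightarrow> real" and E :: "('i, 'o) algorithm"
  assume H: "algorithm_class sz Prob \<C> \<and> A \<in> \<C> \<and> full sz \<gamma> r A \<and>
      (\<forall>j < r. 0 \<le> \<sigma>m j \<and> 0 \<le> \<sigma>M j \<and> \<sigma>m j \<le> \<sigma>M j) \<and>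
      (\<forall>j \<in> {1..r}. \<forall>\<sigma>. \<sigma>m (j - 1) \<le> \<sigma> \<and> \<sigma> \<le> \<sigma>M (j - 1) \<longrightarrow>
         optimal_M sz \<C> \<beta> j \<sigma> (folded sz j A))"
  assume "q \<le> r \<and> (\<forall>i < q. 0 < g i) \<and> protocol_execution sz q A E \<and> E \<in> \<C> \<and>
         (\<forall>i. i + 1 < q \<longrightarrow> g i \<ge> g (i + 1) \<and> l i / g i \<ge> l (i + 1) / g (i + 1)) \<and>
         (\<forall>i < q. (MAX k \<in> {1..q}. \<sigma>m (k - 1) * 2 ^ k / 2 ^ q) \<le> l i / g i \<and>
                  l i / g i \<le> (MIN k \<in> {1..q}. \<sigma>M (k - 1) * 2 ^ k / 2 ^ q))"
  then have q: "q \<le> r" and g: "\<And>i. i < q \<Longrightarrow> 0 < g i" and E: "protocol_execution sz q A E" "E \<in> \<C>"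
    and anti: "\<And>i. i + 1 < q \<Longrightarrow> g i \<ge> g (i + 1) \<and> l i / g i \<ge> l (i + 1) / g (i + 1)"
    and range_Max: "\<And>i. i < q \<Longrightarrow> (MAX k \<in> {1..q}. \<sigma>m (k - 1) * 2 ^ k / 2 ^ q) \<le> l i / g i"
    and range_Min: "\<And>i. i < q \<Longrightarrow> l i / g i \<le> (MIN k \<in> {1..q}. \<sigma>M (k - 1) * 2 ^ k / 2 ^ q)"
    by blast+
  have range_m: "\<sigma>m k * 2 ^ Suc k / 2 ^ q \<le> l i / g i" if "k < q" "i < q" for i k
  proof -
    have "\<sigma>m (Suc k - 1) * 2 ^ Suc k / 2 ^ q \<le> (MAX k \<in> {1..q}. \<sigma>m (k - 1) * 2 ^ k / 2 ^ q)"
      using that by (intro Max_ge imageI) auto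
    with range_Max[OF that(2)] show ?thesis by simp
  qed
  have range_M: "l i / g i \<le> \<sigma>M k * 2 ^ Suc k / 2 ^ q" if "k < q" "i < q" for i k
  proof -
    have "(MIN k \<in> {1..q}. \<sigma>M (k - 1) * 2 ^ k / 2 ^ q) \<le> \<sigma>M (Suc k - 1) * 2 ^ Suc k / 2 ^ q"
      using that by (intro Min_le imageI) auto
    with range_Min[OF that(2)] show ?thesis by simp
  qed
  \<comment> \<open>Nonnegative latencies follow from the lower limit in condition (3), as the
    values of \<open>\<sigma>m\<close> are nonnegative.\<close>
  have lg_nonneg: "0 \<le> l i / g i" if i: "i < q" for i
  proof -
    have "0 \<le> \<sigma>m i * 2 ^ Suc i / 2 ^ q" using H i q by auto
    also have "\<dots> \<le> l i / g i" using range_m i by blast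
    finally show ?thesis .
  qed
  then have l: "0 \<le> l i" if "i < q" for i
    using g[OF that] that by (metis divide_neg_pos not_less)
  have anti': "g k \<le> g i \<and> l k / g k \<le> l i / g i" if "i \<le> k" "k < q" for i k
    using that
  proof (induction k rule: dec_induct)
    case (step k)
    with anti[of k] show ?case by auto
  qed simp
  \<comment> \<open>A latency is the product of \<open>l i / g i\<close> and \<open>g i\<close>,
    both nonnegative and nonincreasing.\<close>
  have l_anti: "l k \<le> l i" if "i \<le> k" "k < q" for i k
  proof -
    have "l k / g k * g k \<le> l i / g i * g i"
      using anti'[OF that] g[OF that(2)] lg_nonneg[of i] that by (intro mult_mono) auto
    with g[of i] g[of k] that show ?thesis by simp
  qed
  have r: "1 \<le> r" and \<gamma>: "0 < \<gamma>" using H by (auto simp: full_def)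
  \<comment> \<open>The bounds on \<open>\<beta>\<close> are contained in optimality itself;
    fullness gives \<open>1 \<le> r\<close>, so the instance with two processors is
    available.\<close>
  with H have "optimal_M sz \<C> \<beta> 1 (\<sigma>m 0) (folded sz 1 A)" by force
  then have \<beta>: "0 < \<beta>" "\<beta> \<le> 1" by (auto simp: optimal_M_def)
  define D where "D = (1 + 1 / \<gamma>) * (lg (2 ^ q))\<^sup>2"
  \<comment> \<open>The truncation of the logarithm at 1 keeps \<open>D\<close> at least 1 even for
    \<open>q = 0\<close>, which makes the witness below at most 1.\<close>
  have "1 \<le> lg (2 ^ q)" by (simp add: lg_def)
  then have "1 \<le> (lg (2 ^ q))\<^sup>2" by simp
  then have D: "1 \<le> D" using \<gamma> mult_mono[of 1 "1 + 1 / \<gamma>" 1 "(lg (2 ^ q))\<^sup>2"] by (simp add: D_def)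
  \<comment> \<open>The 5 is the constant of \<open>protocol_time_bound\<close>. The same witness
    meets both sides of the Theta bound with equality.\<close>
  define \<beta>' where "\<beta>' = 1 / 5 * (\<beta> / D)"
  have "\<beta> / D \<le> 1" using \<beta> D by simp
  then have \<beta>': "0 < \<beta>'" "\<beta>' \<le> 1" using \<beta> D by (simp_all add: \<beta>'_def)
  have "D_time sz E n q g l \<le> 1 / \<beta>' * D_time sz B n q g l"
    if B: "B \<in> \<C>" "runs_on sz q B" and n: "n \<in> range sz" for B n
  \<comment> \<open>For one processor both times are empty sums. This case is separate because
    \<open>lg 1\<close> is 1 and not \<open>q\<close>.\<close>
  proof (cases "q = 0")
    case True
    then show ?thesis by (simp add: D_time_def)
  next
    case False
    have "D_time sz E n q g l \<le> 5 * (1 + 1 / \<gamma>) * (real q)\<^sup>2 / \<beta> * D_time sz B n q g l"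
      using H q g l E anti' l_anti range_m range_M B n \<beta>(1)
      by (intro protocol_time_bound[where Prob = Prob and \<C> = \<C> and A = A and r = r and \<sigma>m = \<sigma>m and \<sigma>M = \<sigma>M]) auto
    also have "5 * (1 + 1 / \<gamma>) * (real q)\<^sup>2 / \<beta> = 1 / \<beta>'"
      using False by (simp add: \<beta>'_def D_def lg_power2 mult.assoc)
    finally show ?thesis .
  qed
  moreover have "runs_on sz q E" using E by (simp add: protocol_execution_def)
  ultimately have "optimal_DBSP sz \<C> \<beta>' q g l E"
    using \<beta>' E by (simp add: optimal_DBSP_def)
  then show "\<exists>\<beta>'. 1 / 5 * (\<beta> / ((1 + 1 / \<gamma>) * (lg (2 ^ q))\<^sup>2)) \<le> \<beta>' \<and>
               \<beta>' \<le> 1 / 5 * (\<beta> / ((1 + 1 / \<gamma>) * (lg (2 ^ q))\<^sup>2)) \<and>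
               optimal_DBSP sz \<C> \<beta>' q g l E"
    unfolding \<beta>'_def D_def by blast
qed

end
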